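(* Suppose that for all $u\in U$ the matrix $\nabla_x^2 f(x^*(u),u)$ is positive definite, and that the map $D(\nabla_x f)$ is Lipschitz continuous on $Z$ with constant $C\ge 0$. Let $u\in U$, $s\in\mathbb R^P$, $0<\alpha\le 1/L(u)$; let $(x^{(k)})_{k\in\mathbb N}$ be generated by $x^{(k+1)}=x^{(k)}-\alpha\nabla_x f(x^{(k)},u)$ with $x^{(0)}=a$, and let $(\dot x^{(k)})_{k\in\mathbb N}$ be generated by $$\dot x^{(k+1)}=\bigl(I-\alpha\nabla_x^2 f(x^{(k)},u)\bigr)\dot x^{(k)}-\alpha\nabla_{xu}f(x^{(k)},u)\,s,\qquad \dot x^{(0)}=0 .$$ Then $(\dot x^{(k)})$ converges to $\dot x^*:=D_u x^*(u)\,s$, and there exist $k_0\ge 0$, $C_1>0$ and $q_{GD}\in[0,1)$ such that for all $k\ge k_0$, $$\|\dot e^{(k)}\|\le q_{GD}^{\,k-k_0}\|\dot e^{(k_0)}\|+C_1(k-k_0)\,q_{GD}^{\,k-k_0}\|e^{(k_0)}\|,$$ where $\dot e^{(k)}:=\dot x^{(k)}-\dot x^*$ and $e^{(k)}:=x^{(k)}-x^*(u)$.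
   Context: Let $N,P\in\mathbb N$, let $U\subset\mathbb R^P$ be open, non-empty and bounded, and let $f:\mathbb R^N\times\mathbb R^P\to\mathbb R$ be twice continuously differentiable on $\mathbb R^N\times U$. For every $u\in U$ the function $f(\cdot,u)$ is convex and has a unique minimizer over $\mathbb R^N$, denoted $x^*(u)$. $\nabla_x f$ is the gradient in $x$, $\nabla_x^2 f$ the $N\times N$ Hessian in $x$, $\nabla_{xu}f$ the $N\times P$ matrix of derivatives of $\nabla_x f$ with respect to $u$, and $D(\nabla_x f)$ the total derivative of $\nabla_x f$ with respect to $(x,u)$. Norms are Euclidean norms and the induced operator norms. $D_ux^*(u)$ is the derivative ($N\times P$ Jacobian) of the map $u\mapsto x^*(u)$, which is continuously differentiable when $\nabla_x^2 f(x^*(u),u)$ is invertible for all $u\in U$. Positive definiteness of $\nabla_x^2 f(x^*(u),u)$ gives, for each $u\in U$, numbers $\varepsilon(u)>0$ and $m(u)>0$ such that $f(\cdot,u)$ is $m(u)$-strongly convex on the closed ball $B_{\varepsilon(u)}(x^*(u))$; these are fixed. A point $a\in\mathbb R^N$ is fixed such that for every $u\in U$ the (bounded) level set $X(u):=\{x\in\mathbb R^N: f(x,u)\le f(a,u)\}$ contains $B_{\varepsilon(u)}(x^*(u))$. Set $Z:=\{(x,u)\in\mathbb R^N\times U: x\in X(u)\}$. $L(u)>0$ is an upper bound on the maximum eigenvalue of $\nabla_x^2 f(x,u)$ over $x\in X(u)$. $\kappa>0$ is an upper bound for $\|\nabla_{xu}f(x,u)\|$ over $(x,u)\in Z$. 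*)

theory Defs
  imports "HOL-Analysis.Analysis"
begin

definition C2_on :: "('a::real_normed_vector \<Rightarrow> 'b::real_normed_vector) \<Rightarrow> 'a set \<Rightarrow> bool" where
  "C2_on f S \<longleftrightarrow>
    (\<exists>(f' :: 'a \<Rightarrow> 'a \<Rightarrow>\<^sub>L 'b) (f'' :: 'a \<Rightarrow> 'a \<Rightarrow>\<^sub>L ('a \<Rightarrow>\<^sub>L 'b)).
      (\<forall>z\<in>S. (f has_derivative blinfun_apply (f' z)) (at z)) \<and>
      (\<forall>z\<in>S. (f' has_derivative blinfun_apply (f'' z)) (at z)) \<and>
      continuous_on S f'')"

definition strongly_convex_on :: "real \<Rightarrow> 'a::real_normed_vector set \<Rightarrow> ('a \<Rightarrow> real) \<Rightarrow> bool" where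
  "strongly_convex_on m S g \<longleftrightarrow> convex S \<and>
    (\<forall>x\<in>S. \<forall>y\<in>S. \<forall>t\<in>{0..1}.
      g ((1 - t) *\<^sub>R x + t *\<^sub>R y)
        \<le> (1 - t) * g x + t * g y - m / 2 * t * (1 - t) * (norm (x - y))\<^sup>2)"

definition positive_definite :: "real^'n^'n \<Rightarrow> bool" where
  "positive_definite A \<longleftrightarrow> transpose A = A \<and> (\<forall>v. v \<noteq> 0 \<longrightarrow> v \<bullet> (A *v v) > 0)"

definition eigenvalue :: "real^'n^'n \<Rightarrow> real \<Rightarrow> bool" where
  "eigenvalue A l \<longleftrightarrow> (\<exists>v. v \<noteq> 0 \<and> A *v v = l *\<^sub>R v)"

definition grad_x :: "((real^'n) \<times> (real^'p) \<Rightarrow> real) \<Rightarrow> real^'n \<Rightarrow> real^'p \<Rightarrow> real^'n" where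
  "grad_x f x u = (THE D. GDERIV (\<lambda>y. f (y, u)) x :> D)"

definition hess_x :: "((real^'n) \<times> (real^'p) \<Rightarrow> real) \<Rightarrow> real^'n \<Rightarrow> real^'p \<Rightarrow> real^'n^'n" where
  "hess_x f x u = jacobian (\<lambda>y. grad_x f y u) (at x)"

text \<open>The type \<^typ>\<open>real^'p^'n\<close> is that of matrices with rows indexed by
  \<^typ>\<open>'n\<close> and columns indexed by \<^typ>\<open>'p\<close>.\<close>

definition grad_xu :: "((real^'n) \<times> (real^'p) \<Rightarrow> real) \<Rightarrow> real^'n \<Rightarrow> real^'p \<Rightarrow> real^'p^'n" where
  "grad_xu f x u = jacobian (\<lambda>v. grad_x f x v) (at u)"

text \<open>The total derivative of the gradient is a bounded linear map on the product space, so that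
  distances between its values are taken in the operator norm; the norm on the product
  is the Euclidean one.\<close>

definition D_grad_x ::
  "((real^'n) \<times> (real^'p) \<Rightarrow> real) \<Rightarrow> (real^'n) \<times> (real^'p) \<Rightarrow>
    ((real^'n) \<times> (real^'p)) \<Rightarrow>\<^sub>L (real^'n)" where
  "D_grad_x f z = Blinfun (frechet_derivative (\<lambda>(x, u). grad_x f x u) (at z))"

definition minimizer :: "((real^'n) \<times> (real^'p) \<Rightarrow> real) \<Rightarrow> real^'p \<Rightarrow> real^'n" where
  "minimizer f u = arg_min (\<lambda>x. f (x, u)) (\<lambda>_. True)"

definition D_minimizer :: "((real^'n) \<times> (real^'p) \<Rightarrow> real) \<Rightarrow> real^'p \<Rightarrow> real^'p^'n" where
  "D_minimizer f u = jacobian (minimizer f) (at u)"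

definition level_set ::
  "((real^'n) \<times> (real^'p) \<Rightarrow> real) \<Rightarrow> real^'n \<Rightarrow> real^'p \<Rightarrow> (real^'n) set" where
  "level_set f a u = {x. f (x, u) \<le> f (a, u)}"

definition Z_set ::
  "((real^'n) \<times> (real^'p) \<Rightarrow> real) \<Rightarrow> real^'n \<Rightarrow> (real^'p) set \<Rightarrow> ((real^'n) \<times> (real^'p)) set" where
  "Z_set f a U = {(x, u). u \<in> U \<and> x \<in> level_set f a u}"

end

(* For fixed u, convexity keeps every gradient step in the level set of a, where the eigenvalue
   bound gives the usual decrease of f(.,u); hence the gradients tend to 0 and x k converges to the
   minimizer z, since the gradient is bounded away from 0 off every ball around z.  The matrix
   I - alpha * Hess f(z,u) is a strict contraction, so by the Lipschitz bound all I - alpha * Hess f(y,u)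
   with y close to z contract with one factor q < 1.  Differentiating grad_x f (z(v),v) = 0 at v = u
   shows that d = D_u z(u) s satisfies Hess f(z,u) d + grad_xu f(z,u) s = 0, so the errors satisfy
     |e(k+1)| <= q |e(k)|,   |de(k+1)| <= q |de(k)| + K |e(k)|
   from some k0 on, and this recurrence unrolls to the claimed rate. *)
theory Submission
  imports Defs
begin

text \<open>Most of the given information is local, and this shapes the proof. \<open>L\<close>
  bounds eigenvalues, while descent needs a bound on the quadratic form of the Hessian. Passing from
  one to the other uses symmetry, which \<open>positive_definite\<close> supplies only at the
  minimizer; at all other points symmetry is derived from the differentiability of the gradient.
  Strong convexity is known only near the minimizer. Convexity turns the growth on a small sphere
  into linear growth outside it. The same device, applied to f(.,v) for v near u, makes the
  minimizer continuous at u, and continuity is what permits differentiating the critical point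
  equation. The step alpha = 1/L is allowed because I - alpha * Hess is then still positive
  semidefinite, so its norm is controlled by its quadratic form alone. The factor k - k0 in the rate
  is a resonance: both errors contract with the same q, and one drives the other.\<close>

subsection \<open>Symmetry of second derivatives\<close>

text \<open>The mean value theorem in direction \<open>v\<close>, applied to the difference
  \<open>\<phi>\<close> in direction \<open>w\<close>, leaves one difference of gradients.
  Linearizing it at \<open>x\<close> gives \<open>t *\<^sub>R H w\<close> and two remainders of size
  at most \<open>e * (t * ?M)\<close>. The assumption \<open>est\<close> is the epsilon-delta form
  of differentiability of \<open>G\<close> at \<open>x\<close>.\<close>

lemma second_difference_estimate:
  fixes f :: "'a::real_inner \<Rightarrow> real"
  assumes f: "\<And>y. (f has_derivative (\<lambda>h. h \<bullet> G y)) (at y)"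
    and lin: "linear H"
    and est: "\<And>y. norm (y - x) < d \<Longrightarrow> norm (G y - G x - H (y - x)) \<le> e * norm (y - x)"
    and t: "t > 0" "t * (norm v + norm w) < d" and e: "e \<ge> 0"
  shows "\<bar>f (x + t *\<^sub>R v + t *\<^sub>R w) - f (x + t *\<^sub>R v) - f (x + t *\<^sub>R w) + f x - t\<^sup>2 * (v \<bullet> H w)\<bar>
    \<le> 2 * e * t\<^sup>2 * (norm v + norm w)\<^sup>2"
proof -
  let ?M = "norm v + norm w"
  define \<phi> where "\<phi> r = f (x + r *\<^sub>R v + t *\<^sub>R w) - f (x + r *\<^sub>R v)" for r
  have der: "(\<phi> has_real_derivative v \<bullet> G (x + r *\<^sub>R v + t *\<^sub>R w) - v \<bullet> G (x + r *\<^sub>R v)) (at r)" for r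
    unfolding \<phi>_def has_field_derivative_def
    by (rule has_derivative_eq_rhs, (rule derivative_intros has_derivative_compose[OF _ f])+)
       (auto simp: fun_eq_iff algebra_simps)
  obtain r where r: "0 < r" "r < t"
    and eq: "\<phi> t - \<phi> 0 = (t - 0) * (v \<bullet> G (x + r *\<^sub>R v + t *\<^sub>R w) - v \<bullet> G (x + r *\<^sub>R v))"
    using MVT2[OF t(1), of \<phi>, OF der] by blast
  define R where "R y = G y - G x - H (y - x)" for y
  have near: "norm (R y) \<le> e * (t * ?M)" if "norm (y - x) \<le> t * ?M" for y
    using est[of y] that t(2) e mult_left_mono[OF that e] unfolding R_def by linarith
  have rv: "norm (r *\<^sub>R v) \<le> t * norm v"
    using r by (auto intro: mult_right_mono)
  have 1: "norm (R (x + r *\<^sub>R v + t *\<^sub>R w)) \<le> e * (t * ?M)"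
    by (rule near) (use rv t(1) norm_triangle_ineq[of "r *\<^sub>R v" "t *\<^sub>R w"] in \<open>auto simp: algebra_simps\<close>)
  have 2: "norm (R (x + r *\<^sub>R v)) \<le> e * (t * ?M)"
    by (rule near) (use rv t(1) in \<open>auto simp: algebra_simps intro: order_trans\<close>)
  have "G (x + r *\<^sub>R v + t *\<^sub>R w) - G (x + r *\<^sub>R v) - t *\<^sub>R H w
      = R (x + r *\<^sub>R v + t *\<^sub>R w) - R (x + r *\<^sub>R v)"
    unfolding R_def using lin by (simp add: linear_add linear_scale)
  then have "v \<bullet> G (x + r *\<^sub>R v + t *\<^sub>R w) - v \<bullet> G (x + r *\<^sub>R v) - t * (v \<bullet> H w)
      = v \<bullet> (R (x + r *\<^sub>R v + t *\<^sub>R w) - R (x + r *\<^sub>R v))"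
    by (metis inner_diff_right inner_scaleR_right)
  then have "\<phi> t - \<phi> 0 - t\<^sup>2 * (v \<bullet> H w) = t * (v \<bullet> (R (x + r *\<^sub>R v + t *\<^sub>R w) - R (x + r *\<^sub>R v)))"
    using eq by (simp only: power2_eq_square diff_0_right mult.assoc right_diff_distrib[symmetric])
  moreover have "\<bar>v \<bullet> (R (x + r *\<^sub>R v + t *\<^sub>R w) - R (x + r *\<^sub>R v))\<bar>
      \<le> norm v * (2 * (e * (t * ?M)))"
    by (rule order_trans[OF Cauchy_Schwarz_ineq2])
      (use norm_triangle_ineq4[of "R (x + r *\<^sub>R v + t *\<^sub>R w)" "R (x + r *\<^sub>R v)"] 1 2
        in \<open>intro mult_left_mono, auto\<close>)
  moreover have "norm v * (2 * (e * (t * ?M))) \<le> ?M * (2 * (e * (t * ?M)))"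
    using e t by (intro mult_right_mono) auto
  ultimately have "\<bar>\<phi> t - \<phi> 0 - t\<^sup>2 * (v \<bullet> H w)\<bar> \<le> t * (?M * (2 * (e * (t * ?M))))"
    using t(1) by (simp add: abs_mult)
  also have "\<dots> = 2 * e * t\<^sup>2 * ?M\<^sup>2"
    by (simp add: power2_eq_square algebra_simps)
  finally show ?thesis
    by (simp add: \<phi>_def algebra_simps)
qed

lemma small_multiple_less:
  fixes M d :: real
  assumes "M \<ge> 0" "d > 0"
  shows "\<exists>t>0. t * M < d"
proof (intro exI conjI)
  show "d / (M + 1) > 0" "d / (M + 1) * M < d"
    using assms by (simp_all add: field_simps)
qed

text \<open>The second difference of \<open>f\<close> is unchanged when \<open>v\<close> and
  \<open>w\<close> are exchanged, so \<open>t\<^sup>2 * (v \<bullet> H w)\<close> and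
  \<open>t\<^sup>2 * (w \<bullet> H v)\<close> approximate the same number. Division by
  \<open>t\<^sup>2\<close> leaves an error proportional to the arbitrary \<open>e\<close>.\<close>

lemma derivative_gradient_symmetric:
  fixes f :: "'a::real_inner \<Rightarrow> real"
  assumes f: "\<And>y. (f has_derivative (\<lambda>h. h \<bullet> G y)) (at y)"
    and G: "(G has_derivative H) (at x)"
  shows "v \<bullet> H w = w \<bullet> H v"
proof -
  let ?M = "norm v + norm w"
  have lin: "linear H"
    using G by (rule has_derivative_linear)
  have bound: "\<bar>v \<bullet> H w - w \<bullet> H v\<bar> \<le> 4 * e * ?M\<^sup>2" if e: "e > 0" for e
  proof -
    obtain d where d: "d > 0"
      and est: "\<And>y. norm (y - x) < d \<Longrightarrow> norm (G y - G x - H (y - x)) \<le> e * norm (y - x)"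
      using G e unfolding has_derivative_at_alt by blast
    obtain t where t: "t > 0" "t * ?M < d"
      using small_multiple_less[of ?M d] d by auto
    have A: "\<bar>f (x + t *\<^sub>R v + t *\<^sub>R w) - f (x + t *\<^sub>R v) - f (x + t *\<^sub>R w) + f x - t\<^sup>2 * (v \<bullet> H w)\<bar>
        \<le> 2 * e * t\<^sup>2 * ?M\<^sup>2"
      by (rule second_difference_estimate[OF f lin est t]) (use e in auto)
    have B: "\<bar>f (x + t *\<^sub>R w + t *\<^sub>R v) - f (x + t *\<^sub>R w) - f (x + t *\<^sub>R v) + f x - t\<^sup>2 * (w \<bullet> H v)\<bar>
        \<le> 2 * e * t\<^sup>2 * (norm w + norm v)\<^sup>2"
      by (rule second_difference_estimate[OF f lin est t(1)])
        (use e t(2) in \<open>simp_all only: add.commute[of "norm w"] less_imp_le\<close>)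
    have swap: "x + t *\<^sub>R w + t *\<^sub>R v = x + t *\<^sub>R v + t *\<^sub>R w"
      by (simp only: add.assoc add.commute[of "t *\<^sub>R w"])
    have "\<bar>t\<^sup>2 * (v \<bullet> H w) - t\<^sup>2 * (w \<bullet> H v)\<bar> \<le> 2 * (2 * e * t\<^sup>2 * ?M\<^sup>2)"
      using A B unfolding swap add.commute[of "norm w"] by linarith
    moreover have "t\<^sup>2 * \<bar>v \<bullet> H w - w \<bullet> H v\<bar> = \<bar>t\<^sup>2 * (v \<bullet> H w) - t\<^sup>2 * (w \<bullet> H v)\<bar>"
      by (simp only: right_diff_distrib[symmetric] abs_mult abs_power2)
    ultimately have "t\<^sup>2 * \<bar>v \<bullet> H w - w \<bullet> H v\<bar> \<le> t\<^sup>2 * (4 * e * ?M\<^sup>2)"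
      by (simp add: mult_ac)
    moreover have "t\<^sup>2 > 0"
      using t(1) by simp
    ultimately show ?thesis
      by (simp only: mult_le_cancel_left_pos)
  qed
  have "\<bar>v \<bullet> H w - w \<bullet> H v\<bar> \<le> 0 + \<epsilon>" if \<epsilon>: "\<epsilon> > 0" for \<epsilon>
  proof -
    obtain e where e: "e > 0" "e * (4 * ?M\<^sup>2) < \<epsilon>"
      using small_multiple_less[of "4 * ?M\<^sup>2" \<epsilon>] \<epsilon> by auto
    then show ?thesis
      using bound[of e] by linarith
  qed
  then show ?thesis
    using field_le_epsilon[of "\<bar>v \<bullet> H w - w \<bullet> H v\<bar>" 0] by simp
qed

subsection \<open>Symmetric quadratic forms\<close>

text \<open>The form at \<open>v + t *\<^sub>R w\<close> is a nonnegative polynomial in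
  \<open>t\<close>. If it is truly quadratic, its minimum gives the inequality; if
  \<open>w \<bullet> A w = 0\<close>, it is affine and its slope must vanish.\<close>

lemma psd_Cauchy_Schwarz:
  fixes A :: "'a::real_inner \<Rightarrow> 'a"
  assumes lin: "linear A" and sym: "\<And>v w. v \<bullet> A w = w \<bullet> A v" and psd: "\<And>v. 0 \<le> v \<bullet> A v"
  shows "(v \<bullet> A w)\<^sup>2 \<le> (v \<bullet> A v) * (w \<bullet> A w)"
proof -
  have exp: "(v + t *\<^sub>R w) \<bullet> A (v + t *\<^sub>R w) = v \<bullet> A v + 2 * t * (v \<bullet> A w) + t\<^sup>2 * (w \<bullet> A w)" for t
    using sym[of w v] lin
    by (simp add: linear_add linear_scale inner_add_left inner_add_right power2_eq_square algebra_simps)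
  show ?thesis
  proof (cases "w \<bullet> A w = 0")
    case True
    have "v \<bullet> A w = 0"
    proof (rule ccontr)
      assume n: "v \<bullet> A w \<noteq> 0"
      \<comment> \<open>For this \<open>t\<close> the affine polynomial takes the value -1.\<close>
      have "v \<bullet> A v + 2 * (- (v \<bullet> A v + 1) / (2 * (v \<bullet> A w))) * (v \<bullet> A w) \<ge> 0"
        using psd[of "v + (- (v \<bullet> A v + 1) / (2 * (v \<bullet> A w))) *\<^sub>R w"] True unfolding exp by simp
      then show False
        using n by (simp add: field_simps)
    qed
    then show ?thesis
      using True by simp
  next
    case False
    then have pos: "w \<bullet> A w > 0"
      using psd[of w] by simp
    have "v \<bullet> A v - (v \<bullet> A w)\<^sup>2 / (w \<bullet> A w) \<ge> 0"
      using psd[of "v + (- (v \<bullet> A w) / (w \<bullet> A w)) *\<^sub>R w"] False unfolding exp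
      by (simp add: power2_eq_square field_simps)
    then show ?thesis
      using pos by (simp add: field_simps)
  qed
qed

text \<open>Cauchy-Schwarz for the form of \<open>A\<close>, taken at \<open>A v\<close> and
  \<open>v\<close>, bounds the fourth power of \<open>norm (A v)\<close> by a product of two values
  of the form. The form bound applies to both, and one factor \<open>(norm (A v))\<^sup>2\<close>
  cancels.\<close>

lemma psd_norm_le:
  fixes A :: "'a::real_inner \<Rightarrow> 'a"
  assumes lin: "linear A" and sym: "\<And>v w. v \<bullet> A w = w \<bullet> A v" and psd: "\<And>v. 0 \<le> v \<bullet> A v"
    and le: "\<And>v. v \<bullet> A v \<le> q * (norm v)\<^sup>2" and q: "q \<ge> 0"
  shows "norm (A v) \<le> q * norm v"
proof (cases "A v = 0")
  case False
  have "(A v \<bullet> A v)\<^sup>2 \<le> (A v \<bullet> A (A v)) * (v \<bullet> A v)"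
    by (rule psd_Cauchy_Schwarz[OF lin sym psd])
  also have "\<dots> \<le> (q * (norm (A v))\<^sup>2) * (q * (norm v)\<^sup>2)"
    using psd le q by (intro mult_mono) auto
  finally have "(norm (A v))\<^sup>2 * (norm (A v))\<^sup>2 \<le> (norm (A v))\<^sup>2 * (q * norm v)\<^sup>2"
    by (simp add: power2_norm_eq_inner[symmetric] power2_eq_square algebra_simps)
  then have "(norm (A v))\<^sup>2 \<le> (q * norm v)\<^sup>2"
    using False by (subst (asm) mult_le_cancel_left_pos) auto
  then show ?thesis
    by (rule power2_le_imp_le) (use q in simp)
qed (use q in auto)

lemma quadratic_form_scale:
  fixes A :: "'a::real_inner \<Rightarrow> 'a"
  assumes "linear A" "v \<noteq> 0"
  shows "v \<bullet> A v = (norm v)\<^sup>2 * (sgn v \<bullet> A (sgn v))"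
  using assms by (simp add: sgn_div_norm linear_scale power2_eq_square field_simps)

lemma sphere_nonempty: "sphere (0::'a::euclidean_space) 1 \<noteq> {}"
  using vector_choose_size[of 1, where 'a='a] by auto

lemma continuous_on_quadratic_form:
  fixes A :: "'a::euclidean_space \<Rightarrow> 'a"
  assumes "linear A"
  shows "continuous_on S (\<lambda>v. v \<bullet> A v)"
  using linear_continuous_on[OF linear_conv_bounded_linear[THEN iffD1, OF assms]]
  by (intro continuous_intros)

lemma symmetric_le_of_eigenvalues_le:
  fixes A :: "'a::euclidean_space \<Rightarrow> 'a"
  assumes lin: "linear A" and sym: "\<And>v w. v \<bullet> A w = w \<bullet> A v"
    and ev: "\<And>v l. v \<noteq> 0 \<Longrightarrow> A v = l *\<^sub>R v \<Longrightarrow> l \<le> L"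
  shows "v \<bullet> A v \<le> L * (norm v)\<^sup>2"
proof -
  \<comment> \<open>A maximizer \<open>e\<close> of the Rayleigh quotient is an eigenvector: \<open>B = l I - A\<close> is positive
    semidefinite with \<open>e \<bullet> B e = 0\<close>, and Cauchy-Schwarz for \<open>B\<close> gives \<open>B e = 0\<close>.\<close>
  obtain e where e: "norm e = 1" and max: "\<And>w. norm w = 1 \<Longrightarrow> w \<bullet> A w \<le> e \<bullet> A e"
    using continuous_attains_sup[OF compact_sphere sphere_nonempty continuous_on_quadratic_form[OF lin]]
    by (metis dist_0_norm mem_sphere)
  define l where "l = e \<bullet> A e"
  have le: "w \<bullet> A w \<le> l * (norm w)\<^sup>2" for w
  proof (cases "w = 0")
    case False
    then show ?thesis
      using max[of "sgn w"] quadratic_form_scale[OF lin False]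
      by (simp add: l_def norm_sgn mult.commute mult_left_mono)
  qed (use lin in \<open>simp add: linear_0\<close>)
  define B where "B w = l *\<^sub>R w - A w" for w
  have B: "linear B" "\<And>v w. v \<bullet> B w = w \<bullet> B v" "\<And>v. 0 \<le> v \<bullet> B v"
    unfolding B_def using lin sym le
    by (auto intro!: linear_compose_sub linear_scale_self simp: linear_iff inner_diff_right inner_commute power2_norm_eq_inner algebra_simps)
  have "e \<bullet> B e = 0"
    using e by (simp add: B_def l_def inner_diff_right power2_norm_eq_inner[symmetric])
  then have "(B e \<bullet> B e)\<^sup>2 \<le> 0"
    using psd_Cauchy_Schwarz[OF B, of "B e" e] by simp
  then have "A e = l *\<^sub>R e"
    by (simp add: B_def)
  then have "l \<le> L"
    using ev[of e l] e by force
  then show ?thesis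
    using le[of v] mult_right_mono[of l L "(norm v)\<^sup>2"] by simp
qed

lemma positive_form_coercive:
  fixes A :: "'a::euclidean_space \<Rightarrow> 'a"
  assumes lin: "linear A" and pos: "\<And>v. v \<noteq> 0 \<Longrightarrow> v \<bullet> A v > 0"
  obtains \<mu> where "\<mu> > 0" "\<And>v. \<mu> * (norm v)\<^sup>2 \<le> v \<bullet> A v"
proof -
  obtain e where e: "norm e = 1" and min: "\<And>w. norm w = 1 \<Longrightarrow> e \<bullet> A e \<le> w \<bullet> A w"
    using continuous_attains_inf[OF compact_sphere sphere_nonempty continuous_on_quadratic_form[OF lin]]
    by (metis dist_0_norm mem_sphere)
  show thesis
  proof
    show "e \<bullet> A e > 0"
      using e pos[of e] by force
    show "(e \<bullet> A e) * (norm v)\<^sup>2 \<le> v \<bullet> A v" for v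
    proof (cases "v = 0")
      case False
      then show ?thesis
        using min[of "sgn v"] quadratic_form_scale[OF lin False]
        by (simp add: norm_sgn mult.commute mult_left_mono)
    qed (use lin in \<open>simp add: linear_0\<close>)
  qed
qed

subsection \<open>Gradient descent on convex functions\<close>

lemma has_real_derivative_along_line:
  fixes g :: "'a::real_inner \<Rightarrow> real"
  assumes g: "\<And>y. (g has_derivative (\<lambda>h. h \<bullet> G y)) (at y)"
  shows "((\<lambda>t. g (y + t *\<^sub>R d)) has_real_derivative d \<bullet> G (y + t *\<^sub>R d)) (at t)"
  unfolding has_field_derivative_def
  by (rule has_derivative_eq_rhs, (rule derivative_intros has_derivative_compose[OF _ g])+)
     (auto simp: fun_eq_iff)

lemma convex_on_above_gradient:
  fixes g :: "'a::real_inner \<Rightarrow> real"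
  assumes g: "\<And>y. (g has_derivative (\<lambda>h. h \<bullet> G y)) (at y)" and cvx: "convex_on UNIV g"
  shows "g z \<ge> g y + (z - y) \<bullet> G y"
proof -
  define \<phi> where "\<phi> t = g (y + t *\<^sub>R (z - y))" for t
  have "\<phi> ((1 - \<theta>) * s + \<theta> * t) \<le> (1 - \<theta>) * \<phi> s + \<theta> * \<phi> t" if "0 \<le> \<theta>" "\<theta> \<le> 1" for \<theta> s t
  proof -
    have "y + ((1 - \<theta>) * s + \<theta> * t) *\<^sub>R (z - y)
        = (1 - \<theta>) *\<^sub>R (y + s *\<^sub>R (z - y)) + \<theta> *\<^sub>R (y + t *\<^sub>R (z - y))"
      by (simp add: algebra_simps)
    then show ?thesis
      unfolding \<phi>_def using convex_onD[OF cvx that] by simp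
  qed
  then have "convex_on UNIV \<phi>"
    by (intro convex_onI) auto
  moreover have "(\<phi> has_real_derivative (z - y) \<bullet> G y) (at 0 within UNIV)"
    using has_real_derivative_along_line[OF g, of y "z - y" 0] by (simp add: \<phi>_def[abs_def])
  ultimately have "\<phi> 1 - \<phi> 0 \<ge> ((z - y) \<bullet> G y) * (1 - 0)"
    by (intro convex_on_imp_above_tangent) auto
  then show ?thesis
    by (simp add: \<phi>_def)
qed

text \<open>The bound on \<open>\<phi>''\<close> is asked for on \<open>[0, T]\<close> only: in the
  descent estimate just this segment is known to lie in the sublevel set.\<close>

lemma second_order_upper_bound:
  fixes \<phi> :: "real \<Rightarrow> real"
  assumes 1: "\<And>t. (\<phi> has_real_derivative \<phi>' t) (at t)"
    and 2: "\<And>t. (\<phi>' has_real_derivative \<phi>'' t) (at t)"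
    and le: "\<And>t. 0 \<le> t \<Longrightarrow> t \<le> T \<Longrightarrow> \<phi>'' t \<le> K" and T: "T \<ge> 0"
  shows "\<phi> T \<le> \<phi> 0 + T * \<phi>' 0 + K * T\<^sup>2 / 2"
proof -
  have d1: "\<phi>' t - K * t \<le> \<phi>' 0" if "0 \<le> t" "t \<le> T" for t
  proof -
    have "\<phi>' t - K * t \<le> \<phi>' 0 - K * 0"
      using that le
      by (intro DERIV_nonpos_imp_nonincreasing[of 0 t "\<lambda>t. \<phi>' t - K * t"])
        (auto intro!: exI derivative_eq_intros 2)
    then show ?thesis by simp
  qed
  have "\<phi> T - T * \<phi>' 0 - K * T\<^sup>2 / 2 \<le> \<phi> 0 - 0 * \<phi>' 0 - K * 0\<^sup>2 / 2"
  proof (rule DERIV_nonpos_imp_nonincreasing[OF T, of "\<lambda>t. \<phi> t - t * \<phi>' 0 - K * t\<^sup>2 / 2"])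
    fix t assume t: "0 \<le> t" "t \<le> T"
    have "((\<lambda>t. \<phi> t - t * \<phi>' 0 - K * t\<^sup>2 / 2) has_real_derivative \<phi>' t - \<phi>' 0 - K * t) (at t)"
      by (auto intro!: derivative_eq_intros 1)
    then show "\<exists>y. ((\<lambda>t. \<phi> t - t * \<phi>' 0 - K * t\<^sup>2 / 2) has_real_derivative y) (at t) \<and> y \<le> 0"
      using d1[OF t] by fastforce
  qed
  then show ?thesis by simp
qed

lemma gradient_step_decrease:
  fixes g :: "'a::real_inner \<Rightarrow> real"
  assumes g: "\<And>y. (g has_derivative (\<lambda>h. h \<bullet> G y)) (at y)"
    and G: "\<And>y. (G has_derivative H y) (at y)"
    and cvx: "convex_on UNIV g"
    and H_le: "\<And>y v. g y \<le> c \<Longrightarrow> v \<bullet> H y v \<le> L * (norm v)\<^sup>2"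
    and y: "g y \<le> c" and L: "L > 0" and \<alpha>: "0 < \<alpha>" "\<alpha> \<le> 1 / L"
  shows "g (y - \<alpha> *\<^sub>R G y) \<le> g y - \<alpha> / 2 * (norm (G y))\<^sup>2"
proof (cases "G y = 0")
  case False
  define N where "N = (norm (G y))\<^sup>2"
  have N: "N > 0" "G y \<bullet> G y = N"
    using False by (auto simp: N_def power2_norm_eq_inner)
  define \<phi> where "\<phi> t = g (y + t *\<^sub>R (- G y))" for t
  define \<phi>' where "\<phi>' t = - G y \<bullet> G (y + t *\<^sub>R (- G y))" for t
  have 1: "(\<phi> has_real_derivative \<phi>' t) (at t)" for t
    unfolding \<phi>_def \<phi>'_def by (rule has_real_derivative_along_line[OF g])
  have 2: "(\<phi>' has_real_derivative G y \<bullet> H (y + t *\<^sub>R (- G y)) (G y)) (at t)" for t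
    unfolding \<phi>'_def has_field_derivative_def
    by (rule has_derivative_eq_rhs, (rule derivative_intros has_derivative_compose[OF _ G])+)
       (use has_derivative_linear[OF G] in \<open>auto simp: fun_eq_iff linear_neg linear_scale linear_0 scaleR_minus_left[symmetric] simp del: scaleR_minus_left\<close>)
  have upper: "\<phi> T \<le> \<phi> 0 - T * (1 - L * T / 2) * N" if T: "T \<ge> 0" and le: "\<phi> T \<le> \<phi> 0" for T
  proof -
    have inside: "\<phi> t \<le> \<phi> 0" if t: "0 \<le> t" "t \<le> T" for t
    proof (cases "T = 0")
      case False
      then have *: "0 \<le> t / T" "t / T \<le> 1"
        using t T by auto
      have "y + t *\<^sub>R (- G y) = (1 - t / T) *\<^sub>R (y + 0 *\<^sub>R (- G y)) + (t / T) *\<^sub>R (y + T *\<^sub>R (- G y))"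
        using False by (simp add: algebra_simps)
      then have "\<phi> t \<le> (1 - t / T) * \<phi> 0 + (t / T) * \<phi> T"
        unfolding \<phi>_def using convex_onD[OF cvx *, of "y + 0 *\<^sub>R (- G y)" "y + T *\<^sub>R (- G y)"] by simp
      also have "\<dots> \<le> (1 - t / T) * \<phi> 0 + (t / T) * \<phi> 0"
        using le * by (intro add_left_mono mult_left_mono)
      finally show ?thesis
        by (simp add: algebra_simps)
    qed (use t in simp)
    have "\<phi> T \<le> \<phi> 0 + T * \<phi>' 0 + (L * N) * T\<^sup>2 / 2"
    proof (rule second_order_upper_bound[OF 1 2 _ T])
      fix t assume "0 \<le> t" "t \<le> T"
      then have "g (y + t *\<^sub>R (- G y)) \<le> c"
        using inside[of t] y by (simp add: \<phi>_def)
      then show "G y \<bullet> H (y + t *\<^sub>R (- G y)) (G y) \<le> L * N"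
        unfolding N_def by (rule H_le)
    qed
    then show ?thesis
      by (simp add: \<phi>'_def N power2_eq_square algebra_simps)
  qed
  \<comment> \<open>This is where the step size restriction enters: \<open>L * T \<le> 1\<close>
    leaves at least half of the first-order decrease, hence the factor \<open>\<alpha> / 2\<close>
    in the conclusion.\<close>
  have small: "T * (1 - L * T / 2) \<ge> T / 2" if "T \<ge> 0" "T \<le> \<alpha>" for T
  proof -
    have "L * T \<le> 1"
      using that \<alpha> L by (simp add: field_simps) (smt (verit) mult_left_mono)
    then show ?thesis
      using that mult_left_mono[of "1/2" "1 - L * T / 2" T] by simp
  qed
  \<comment> \<open>The bound on the Hessian is only available on the sublevel set. If the step left it, \<open>\<phi>\<close> would
    return to its initial value at some \<open>0 < T \<le> \<alpha>\<close>; by convexity the segment up to \<open>T\<close> stays in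
    the set, so the quadratic upper bound applies there and gives \<open>\<phi> T < \<phi> 0\<close>.\<close>
  have "\<phi> \<alpha> \<le> \<phi> 0"
  proof (rule ccontr)
    assume up: "\<not> \<phi> \<alpha> \<le> \<phi> 0"
    have "\<phi>' 0 < 0"
      using N by (simp add: \<phi>'_def)
    then obtain d where d: "d > 0" "\<And>h. 0 < h \<Longrightarrow> h < d \<Longrightarrow> \<phi> (0 + h) < \<phi> 0"
      using DERIV_neg_dec_right[OF 1[of 0]] by blast
    \<comment> \<open>Starting the intermediate value argument at \<open>h\<close>, where
      \<open>\<phi>\<close> is already below \<open>\<phi> 0\<close>, excludes the trivial solution
      \<open>T = 0\<close>.\<close>
    define h where "h = min (d / 2) \<alpha>"
    have h: "0 < h" "h \<le> \<alpha>" "\<phi> h < \<phi> 0"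
      using d(1) d(2)[of h] \<alpha> by (auto simp: h_def)
    obtain T where T: "h \<le> T" "T \<le> \<alpha>" "\<phi> T = \<phi> 0"
      using IVT[of \<phi> h "\<phi> 0" \<alpha>] h up DERIV_isCont[OF 1] by force
    have "T / 2 * N > 0"
      using T h N by simp
    moreover have "T / 2 * N \<le> T * (1 - L * T / 2) * N"
      using small[of T] T h N by (intro mult_right_mono) auto
    moreover have "\<phi> T \<le> \<phi> 0 - T * (1 - L * T / 2) * N"
      using T h by (intro upper) auto
    ultimately show False
      using T(3) by linarith
  qed
  then have "\<phi> \<alpha> \<le> \<phi> 0 - \<alpha> * (1 - L * \<alpha> / 2) * N"
    using upper[of \<alpha>] \<alpha> by simp
  moreover have "\<alpha> / 2 * N \<le> \<alpha> * (1 - L * \<alpha> / 2) * N"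
    using small[of \<alpha>] \<alpha> N by (intro mult_right_mono) auto
  ultimately show ?thesis
    by (simp add: \<phi>_def N_def)
qed simp

text \<open>The midpoint of \<open>z\<close> and \<open>y\<close> suffices: its value is at least
  \<open>g z\<close>, and the strong convexity term there is \<open>m / 8\<close> times the squared
  distance. Doubling gives \<open>m / 4\<close>.\<close>

lemma strongly_convex_growth:
  fixes g :: "'a::real_normed_vector \<Rightarrow> real"
  assumes sc: "strongly_convex_on m (cball z \<epsilon>) g" and min: "\<And>y. g z \<le> g y"
    and y: "norm (y - z) \<le> \<epsilon>"
  shows "g y \<ge> g z + m / 4 * (norm (y - z))\<^sup>2"
proof -
  have \<epsilon>: "\<epsilon> \<ge> 0"
    using y norm_ge_zero order_trans by blast
  define w where "w = (1 - 1/2) *\<^sub>R z + (1/2) *\<^sub>R y"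
  have "z \<in> cball z \<epsilon>" "y \<in> cball z \<epsilon>" "1 / 2 \<in> {0..1::real}"
    using y \<epsilon> by (auto simp: dist_norm norm_minus_commute)
  then have "g w \<le> (1 - 1/2) * g z + 1/2 * g y - m / 2 * (1/2) * (1 - 1/2) * (norm (z - y))\<^sup>2"
    using sc unfolding strongly_convex_on_def w_def by blast
  then show ?thesis
    using min[of w] unfolding norm_minus_commute[of z] by simp
qed

text \<open>The segment from \<open>z\<close> to \<open>y\<close> crosses the sphere at
  \<open>w\<close>, and convexity along it bounds \<open>g y\<close> from below. The centre
  \<open>z\<close> is arbitrary, so the lemma also applies to a perturbed function around the
  minimizer of the unperturbed one.\<close>

lemma convex_growth_beyond_sphere:
  fixes g :: "'a::real_normed_vector \<Rightarrow> real"
  assumes cvx: "convex_on UNIV g" and r: "r > 0" "norm (y - z) \<ge> r"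
    and sphere: "\<And>w. norm (w - z) = r \<Longrightarrow> g w \<ge> g z + b"
  shows "g y \<ge> g z + b / r * norm (y - z)"
proof -
  define n where "n = norm (y - z)"
  have n: "n > 0" "r \<le> n"
    using r by (auto simp: n_def)
  define w where "w = (1 - r / n) *\<^sub>R z + (r / n) *\<^sub>R y"
  have "w - z = (r / n) *\<^sub>R (y - z)"
    by (simp add: w_def algebra_simps)
  then have "norm (w - z) = r"
    using n r by (simp add: n_def)
  then have "g z + b \<le> g w"
    by (rule sphere)
  also have "g w \<le> (1 - r / n) * g z + (r / n) * g y"
    unfolding w_def using n r by (intro convex_onD[OF cvx]) auto
  finally have "b \<le> (r / n) * (g y - g z)"
    by (simp add: algebra_simps)
  then show ?thesis
    using n r unfolding n_def[symmetric] by (simp add: field_simps)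
qed

lemma gradient_descent_tendsto:
  fixes g :: "'a::real_inner \<Rightarrow> real"
  assumes g: "\<And>y. (g has_derivative (\<lambda>h. h \<bullet> G y)) (at y)"
    and cvx: "convex_on UNIV g"
    and min: "\<And>y. g z \<le> g y"
    and sc: "strongly_convex_on m (cball z \<epsilon>) g" and m: "m > 0" and \<epsilon>: "\<epsilon> > 0"
    and decrease: "\<And>k. g (x (Suc k)) \<le> g (x k) - c * (norm (G (x k)))\<^sup>2" and c: "c > 0"
  shows "x \<longlonglongrightarrow> z"
proof -
  have "decseq (\<lambda>k. g (x k))"
    using c decrease by (intro decseq_SucI) (smt (verit) mult_nonneg_nonneg zero_le_power2)
  then obtain l where l: "(\<lambda>k. g (x k)) \<longlonglongrightarrow> l"
    using decseq_convergent[of "\<lambda>k. g (x k)" "g z"] min by blast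
  have "(\<lambda>k. (g (x k) - g (x (Suc k))) / c) \<longlonglongrightarrow> (l - l) / c"
    using c by (intro tendsto_intros l LIMSEQ_Suc[OF l]) auto
  then have lim: "(\<lambda>k. (g (x k) - g (x (Suc k))) / c) \<longlonglongrightarrow> 0"
    by simp
  have "(norm (G (x k)))\<^sup>2 \<le> (g (x k) - g (x (Suc k))) / c" for k
    using decrease[of k] c by (simp add: pos_le_divide_eq mult.commute)
  then have "(\<lambda>k. (norm (G (x k)))\<^sup>2) \<longlonglongrightarrow> 0"
    by (intro real_tendsto_sandwich[OF _ _ tendsto_const lim] always_eventually allI) auto
  then have G0: "(\<lambda>k. norm (G (x k))) \<longlonglongrightarrow> 0"
    using tendsto_real_sqrt[of "\<lambda>k. (norm (G (x k)))\<^sup>2" 0 sequentially] by simp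
  \<comment> \<open>Quadratic growth on the sphere of radius \<open>r\<close> becomes linear growth
    of slope \<open>m / 4 * r\<close> outside. The tangent inequality bounds the same increase by
    \<open>norm (G y) * norm (y - z)\<close>.\<close>
  have away: "norm (G y) \<ge> m / 4 * r" if r: "0 < r" "r \<le> \<epsilon>" "norm (y - z) \<ge> r" for r y
  proof -
    have "g y \<ge> g z + (m / 4 * r\<^sup>2) / r * norm (y - z)"
      using strongly_convex_growth[OF sc min] r
      by (intro convex_growth_beyond_sphere[OF cvx]) auto
    moreover have "g z \<ge> g y + (z - y) \<bullet> G y"
      by (rule convex_on_above_gradient[OF g cvx])
    ultimately have "m / 4 * r * norm (y - z) \<le> - ((z - y) \<bullet> G y)"
      using r by (simp add: power2_eq_square)
    also have "\<dots> \<le> norm (G y) * norm (y - z)"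
      using Cauchy_Schwarz_ineq2[of "z - y" "G y"] by (simp add: norm_minus_commute mult.commute)
    finally show ?thesis
      using r by (subst (asm) mult_le_cancel_right_pos) auto
  qed
  show ?thesis
  proof (rule LIMSEQ_I)
    fix e :: real assume "e > 0"
    define r where "r = min e \<epsilon>"
    have r: "0 < r" "r \<le> \<epsilon>" "r \<le> e"
      using \<open>e > 0\<close> \<epsilon> by (auto simp: r_def)
    have "eventually (\<lambda>k. norm (G (x k)) < m / 4 * r) sequentially"
      using G0 r m by (intro order_tendstoD) auto
    then obtain K where "\<And>k. k \<ge> K \<Longrightarrow> norm (G (x k)) < m / 4 * r"
      by (auto simp: eventually_sequentially)
    then show "\<exists>K. \<forall>k\<ge>K. norm (x k - z) < e"
      using away[OF r(1,2)] r(3) by (meson not_le order_less_le_trans)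
  qed
qed

text \<open>The forcing term \<open>K * e\<close> decays with the same ratio \<open>q\<close> as the
  homogeneous part, so each step adds one more equal share; this produces the factor
  \<open>n\<close>. The share is \<open>K / q\<close> because the forcing at step \<open>n\<close>
  carries \<open>q ^ n\<close> and is collected into \<open>q ^ Suc n\<close>.\<close>

lemma coupled_linear_recurrence:
  fixes d e :: "nat \<Rightarrow> real"
  assumes e: "\<And>k. k \<ge> k0 \<Longrightarrow> e (Suc k) \<le> q * e k"
    and d: "\<And>k. k \<ge> k0 \<Longrightarrow> d (Suc k) \<le> q * d k + K * e k"
    and q: "0 < q" and K: "K \<ge> 0"
  shows "d (k0 + n) \<le> q ^ n * d k0 + K / q * real n * q ^ n * e k0"
proof -
  have en: "e (k0 + n) \<le> q ^ n * e k0" for n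
  proof (induction n)
    case (Suc n)
    have "e (k0 + Suc n) \<le> q * e (k0 + n)"
      using e[of "k0 + n"] by simp
    also have "\<dots> \<le> q * (q ^ n * e k0)"
      using Suc q by (intro mult_left_mono) auto
    finally show ?case by (simp add: mult_ac)
  qed simp
  show ?thesis
  proof (induction n)
    case (Suc n)
    have "d (k0 + Suc n) \<le> q * d (k0 + n) + K * e (k0 + n)"
      using d[of "k0 + n"] by simp
    also have "\<dots> \<le> q * (q ^ n * d k0 + K / q * real n * q ^ n * e k0) + K * (q ^ n * e k0)"
      using Suc en[of n] q K by (intro add_mono mult_left_mono) auto
    also have "\<dots> = q ^ Suc n * d k0 + K / q * real (Suc n) * q ^ Suc n * e k0"
      using q by (simp add: field_simps)
    finally show ?case .
  qed simp
qed

subsection \<open>Partial derivatives\<close>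

lemma has_derivative_sections:
  assumes F: "(F has_derivative F') (at (y, v))"
  shows "((\<lambda>y. F (y, v)) has_derivative (\<lambda>h. F' (h, 0))) (at y)"
    and "((\<lambda>v. F (y, v)) has_derivative (\<lambda>k. F' (0, k))) (at v)"
proof -
  have "((\<lambda>y. (y, v)) has_derivative (\<lambda>h. (h, 0))) (at y)"
    "((\<lambda>v. (y, v)) has_derivative (\<lambda>k. (0, k))) (at v)"
    by (intro has_derivative_Pair has_derivative_ident has_derivative_const)+
  from has_derivative_compose[OF this(1) F] has_derivative_compose[OF this(2) F]
  show "((\<lambda>y. F (y, v)) has_derivative (\<lambda>h. F' (h, 0))) (at y)"
    and "((\<lambda>v. F (y, v)) has_derivative (\<lambda>k. F' (0, k))) (at v)" .
qed

text \<open>The Riesz representative is written out in coordinates because this expression is linear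
  in \<open>\<phi>\<close>; with \<open>\<phi> = f' z\<close> it can then be differentiated in
  \<open>z\<close>.\<close>

lemma partial_gradient:
  fixes f :: "(real^'n) \<times> (real^'p) \<Rightarrow> real"
  assumes f: "(f has_derivative blinfun_apply \<phi>) (at (y, v))"
  shows "GDERIV (\<lambda>y. f (y, v)) y :> (\<Sum>b\<in>Basis. blinfun_apply \<phi> (b, 0) *\<^sub>R b)"
proof -
  have der: "((\<lambda>y. f (y, v)) has_derivative (\<lambda>h. blinfun_apply \<phi> (h, 0))) (at y)"
    by (rule has_derivative_sections(1)[OF f])
  have "blinfun_apply \<phi> (h, 0) = h \<bullet> (\<Sum>b\<in>Basis. blinfun_apply \<phi> (b, 0) *\<^sub>R b)" for h
  proof -
    have lin: "linear (\<lambda>h. blinfun_apply \<phi> (h, 0))"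
      using der by (rule has_derivative_linear)
    have "blinfun_apply \<phi> (h, 0) = blinfun_apply \<phi> (\<Sum>b\<in>Basis. (h \<bullet> b) *\<^sub>R b, 0)"
      by (simp only: euclidean_representation)
    also have "\<dots> = (\<Sum>b\<in>Basis. (h \<bullet> b) * blinfun_apply \<phi> (b, 0))"
      using linear_sum[OF lin, of "\<lambda>b. (h \<bullet> b) *\<^sub>R b" Basis] linear_scale[OF lin] by simp
    finally show ?thesis
      by (simp add: inner_sum_right mult.commute)
  qed
  then have "(\<lambda>h. blinfun_apply \<phi> (h, 0)) = (\<lambda>h. h \<bullet> (\<Sum>b\<in>Basis. blinfun_apply \<phi> (b, 0) *\<^sub>R b))"
    by (rule ext)
  from subst[OF this, of "\<lambda>D. ((\<lambda>y. f (y, v)) has_derivative D) (at y)", OF der] show ?thesis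
    unfolding gderiv_def .
qed

lemma GDERIV_unique:
  fixes D D' :: "'a::real_inner"
  assumes "GDERIV g x :> D" "GDERIV g x :> D'"
  shows "D = D'"
proof -
  have "(\<lambda>h. h \<bullet> D) = (\<lambda>h. h \<bullet> D')"
    using assms unfolding gderiv_def by (rule has_derivative_unique)
  then have "(D - D') \<bullet> (D - D') = 0"
    by (metis inner_diff_right right_minus_eq)
  then show ?thesis
    by simp
qed

lemma grad_x_eqI: "GDERIV (\<lambda>y. f (y, v)) y :> D \<Longrightarrow> grad_x f y v = D"
  unfolding grad_x_def by (rule the_equality, assumption) (erule (1) GDERIV_unique)

lemma C2_onE:
  assumes "C2_on f S"
  obtains f' f'' where
    "\<And>z. z \<in> S \<Longrightarrow> (f has_derivative blinfun_apply (f' z)) (at z)"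
    "\<And>z. z \<in> S \<Longrightarrow> (f' has_derivative blinfun_apply (f'' z)) (at z)"
proof -
  from assms obtain f' f'' where
    1: "\<forall>z\<in>S. (f has_derivative blinfun_apply (f' z)) (at z)"
    and 2: "\<forall>z\<in>S. (f' has_derivative blinfun_apply (f'' z)) (at z)"
    unfolding C2_on_def by (elim exE conjE)
  show thesis
    by (rule that) (erule bspec[OF 1], erule bspec[OF 2])
qed

lemma C2_on_GDERIV_grad_x:
  fixes f :: "(real^'n) \<times> (real^'p) \<Rightarrow> real"
  assumes "C2_on f (UNIV \<times> U)" "v \<in> U"
  shows "((\<lambda>y. f (y, v)) has_derivative (\<lambda>h. h \<bullet> grad_x f y v)) (at y)"
proof -
  obtain f' where f': "\<And>z. z \<in> UNIV \<times> U \<Longrightarrow> (f has_derivative blinfun_apply (f' z)) (at z)"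
    by (rule C2_onE[OF assms(1)]) (rule that)
  have "(f has_derivative blinfun_apply (f' (y, v))) (at (y, v))"
    by (rule f') (use assms(2) in simp)
  from partial_gradient[OF this] show ?thesis
    unfolding gderiv_def[symmetric] by (simp add: grad_x_eqI)
qed

lemma C2_on_imp_continuous_on:
  assumes "C2_on f S"
  shows "continuous_on S f"
proof (rule continuous_at_imp_continuous_on, rule ballI)
  fix z assume z: "z \<in> S"
  obtain f' where f': "\<And>z. z \<in> S \<Longrightarrow> (f has_derivative blinfun_apply (f' z)) (at z)"
    by (rule C2_onE[OF assms]) (rule that)
  show "isCont f z"
    by (rule has_derivative_continuous[OF f'[OF z]])
qed

text \<open>On \<open>UNIV \<times> U\<close> the gradient is a fixed linear image of
  \<open>f'\<close>, so \<open>f''\<close> provides its derivative. Openness of \<open>U\<close>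
  lets this local identity be differentiated.\<close>

lemma C2_on_differentiable_grad_x:
  fixes f :: "(real^'n) \<times> (real^'p) \<Rightarrow> real"
  assumes C2: "C2_on f (UNIV \<times> U)" and U: "open U" and v: "v \<in> U"
  shows "(\<lambda>(y, v). grad_x f y v) differentiable (at (y, v))"
proof -
  obtain f' f''
    where f': "\<And>z. z \<in> UNIV \<times> U \<Longrightarrow> (f has_derivative blinfun_apply (f' z)) (at z)"
      and f'': "\<And>z. z \<in> UNIV \<times> U \<Longrightarrow> (f' has_derivative blinfun_apply (f'' z)) (at z)"
    by (rule C2_onE[OF C2]) (rule that)
  define z where "z = (y, v)"
  have z: "z \<in> UNIV \<times> U"
    using v by (simp add: z_def)
  have "((\<lambda>z. \<Sum>b\<in>Basis. blinfun_apply (f' z) (b, 0) *\<^sub>R b) has_derivative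
      (\<lambda>h. \<Sum>b\<in>Basis. blinfun_apply (blinfun_apply (f'' z) h) (b, 0) *\<^sub>R b)) (at z)"
    by (intro has_derivative_sum has_derivative_scaleR_left
        bounded_linear.has_derivative[OF blinfun.bounded_linear_left] f'' z)
  then have "((\<lambda>(y, v). grad_x f y v) has_derivative
      (\<lambda>h. \<Sum>b\<in>Basis. blinfun_apply (blinfun_apply (f'' z) h) (b, 0) *\<^sub>R b)) (at z)"
  proof (rule has_derivative_transform_within_open)
    show "open (UNIV \<times> U)"
      using U by (intro open_Times) auto
    fix w :: "(real^'n) \<times> (real^'p)" assume "w \<in> UNIV \<times> U"
    then show "(\<Sum>b\<in>Basis. blinfun_apply (f' w) (b, 0) *\<^sub>R b) = (case w of (y, v) \<Rightarrow> grad_x f y v)"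
      using f'[of w] by (cases w) (simp add: grad_x_eqI[OF partial_gradient])
  qed (use z in simp)
  then show ?thesis
    unfolding z_def by (rule differentiableI)
qed

text \<open>The matrices are defined as Jacobians of sections. Since the total derivative
  \<open>F'\<close> exists, they represent \<open>F' (h, 0)\<close> and \<open>F' (0, k)\<close>,
  and linearity adds the two.\<close>

lemma C2_on_derivative_grad_x:
  fixes f :: "(real^'n) \<times> (real^'p) \<Rightarrow> real"
  assumes C2: "C2_on f (UNIV \<times> U)" and U: "open U" and v: "v \<in> U"
  shows "((\<lambda>(y, v). grad_x f y v) has_derivative (\<lambda>(h, k). hess_x f y v *v h + grad_xu f y v *v k))
      (at (y, v))" (is ?total)
    and "((\<lambda>y. grad_x f y v) has_derivative (\<lambda>h. hess_x f y v *v h)) (at y)" (is ?hess)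
    and "blinfun_apply (D_grad_x f (y, v)) (h, k) = hess_x f y v *v h + grad_xu f y v *v k" (is ?D)
proof -
  define F where "F = (\<lambda>(y, v). grad_x f y v)"
  define F' where "F' = frechet_derivative F (at (y, v))"
  have F': "(F has_derivative F') (at (y, v))"
    unfolding F'_def F_def
    using C2_on_differentiable_grad_x[OF assms] by (simp add: frechet_derivative_works)
  have lin: "linear F'"
    using F' by (rule has_derivative_linear)
  have 1: "((\<lambda>y. grad_x f y v) has_derivative (\<lambda>h. F' (h, 0))) (at y)"
    using has_derivative_sections(1)[OF F'] by (simp add: F_def)
  have 2: "((\<lambda>v. grad_x f y v) has_derivative (\<lambda>k. F' (0, k))) (at v)"
    using has_derivative_sections(2)[OF F'] by (simp add: F_def)
  have h: "hess_x f y v *v h = F' (h, 0)" for h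
    unfolding hess_x_def jacobian_def frechet_derivative_at[OF 1, symmetric]
    by (rule fun_cong[OF matrix_vector_mul(2)[OF has_derivative_linear[OF 1]]])
  have k: "grad_xu f y v *v k = F' (0, k)" for k
    unfolding grad_xu_def jacobian_def frechet_derivative_at[OF 2, symmetric]
    by (rule fun_cong[OF matrix_vector_mul(2)[OF has_derivative_linear[OF 2]]])
  have hk: "F' (h, k) = hess_x f y v *v h + grad_xu f y v *v k" for h k
    using linear_add[OF lin, of "(h, 0)" "(0, k)"] by (simp add: h k)
  show ?total
  proof -
    have "F' = (\<lambda>(h, k). hess_x f y v *v h + grad_xu f y v *v k)"
      using hk by auto
    then show ?thesis
      using F' unfolding F_def by simp
  qed
  show ?hess
    using 1 by (simp add: h[abs_def])
  show ?D
    using bounded_linear_Blinfun_apply[OF has_derivative_bounded_linear[OF F']] hk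
    by (simp add: D_grad_x_def F'_def F_def)
qed

text \<open>Points with equal parameter have distance \<open>norm (y - z)\<close> in the product,
  and \<open>(h, 0)\<close>, \<open>(0, k)\<close> have norms \<open>norm h\<close>,
  \<open>norm k\<close>. So both blocks inherit the constant \<open>C\<close> unchanged.\<close>

lemma lipschitz_hess_x_grad_xu:
  fixes f :: "(real^'n) \<times> (real^'p) \<Rightarrow> real"
  assumes C2: "C2_on f (UNIV \<times> U)" and U: "open U" and v: "v \<in> U"
    and lip: "lipschitz_on C (Z_set f a U) (D_grad_x f)"
    and y: "y \<in> level_set f a v" "z \<in> level_set f a v"
  shows "norm (hess_x f y v *v h - hess_x f z v *v h) \<le> C * norm (y - z) * norm h"
    and "norm (grad_xu f y v *v k - grad_xu f z v *v k) \<le> C * norm (y - z) * norm k"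
proof -
  have "dist (D_grad_x f (y, v)) (D_grad_x f (z, v)) \<le> C * dist (y, v) (z, v)"
    using y v by (intro lipschitz_onD[OF lip]) (auto simp: Z_set_def)
  then have D: "norm (D_grad_x f (y, v) - D_grad_x f (z, v)) \<le> C * norm (y - z)"
    by (simp add: dist_norm norm_Pair)
  have "norm (blinfun_apply (D_grad_x f (y, v) - D_grad_x f (z, v)) w) \<le> C * norm (y - z) * norm w" for w
    using norm_blinfun[of "D_grad_x f (y, v) - D_grad_x f (z, v)" w] mult_right_mono[OF D norm_ge_zero[of w]]
    by linarith
  from this[of "(h, 0)"] this[of "(0, k)"]
  show "norm (hess_x f y v *v h - hess_x f z v *v h) \<le> C * norm (y - z) * norm h"
    and "norm (grad_xu f y v *v k - grad_xu f z v *v k) \<le> C * norm (y - z) * norm k"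
    by (simp_all add: blinfun.diff_left C2_on_derivative_grad_x(3)[OF C2 U v] norm_Pair)
qed

subsection \<open>The minimizer as an implicit function\<close>

lemma minimizer_le:
  assumes "\<exists>!y. is_arg_min (\<lambda>y. f (y, v)) (\<lambda>_. True) y"
  shows "f (minimizer f v, v) \<le> f (y, v)"
proof -
  have "is_arg_min (\<lambda>y. f (y, v)) (\<lambda>_. True) (minimizer f v)"
    unfolding minimizer_def arg_min_def using assms by (rule ex1_implies_ex[THEN someI_ex])
  then show ?thesis
    by (simp add: is_arg_min_def not_less)
qed

lemma grad_x_minimizer_eq_0:
  assumes "((\<lambda>y. f (y, v)) has_derivative (\<lambda>h. h \<bullet> grad_x f z v)) (at z)"
    and "\<And>y. f (z, v) \<le> f (y, v)"
  shows "grad_x f z v = 0"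
proof -
  have "(\<lambda>h. h \<bullet> grad_x f z v) = (\<lambda>h. 0)"
    using assms(2) by (intro differential_zero_maxmin[OF UNIV_I open_UNIV assms(1)]) simp
  then have "grad_x f z v \<bullet> grad_x f z v = 0"
    by (rule fun_cong)
  then show ?thesis
    by simp
qed

text \<open>For \<open>v\<close> near \<open>u\<close>, \<open>f (y, v)\<close> is uniformly close
  to \<open>f (y, u)\<close> on a compact ball around \<open>z u\<close>. The growth on its boundary
  survives, convexity carries it outwards, and no minimizer for \<open>v\<close> can lie
  outside.\<close>

lemma continuous_minimizers:
  fixes f :: "'a::euclidean_space \<times> 'b::metric_space \<Rightarrow> real"
  assumes cont: "continuous_on (UNIV \<times> U) f" and U: "open U" and u: "u \<in> U"
    and cvx: "\<And>v. v \<in> U \<Longrightarrow> convex_on UNIV (\<lambda>y. f (y, v))"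
    and min: "\<And>v y. v \<in> U \<Longrightarrow> f (z v, v) \<le> f (y, v)"
    and growth: "\<And>y. norm (y - z u) \<le> \<epsilon> \<Longrightarrow> f (y, u) \<ge> f (z u, u) + c * (norm (y - z u))\<^sup>2"
    and c: "c > 0" and \<epsilon>: "\<epsilon> > 0"
  shows "isCont z u"
  unfolding continuous_at_eps_delta
proof (intro allI impI)
  fix e :: real assume "e > 0"
  define r where "r = min e \<epsilon>"
  have r: "0 < r" "r \<le> \<epsilon>" "r \<le> e"
    using \<open>e > 0\<close> \<epsilon> by (auto simp: r_def)
  \<comment> \<open>The growth on the sphere is \<open>4 * b\<close>; replacing \<open>u\<close> by
    \<open>v\<close> costs at most \<open>b\<close> there and \<open>b\<close> at the centre, which
    leaves \<open>2 * b\<close>.\<close>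
  define b where "b = c * r\<^sup>2 / 4"
  have b: "b > 0"
    using c r by (simp add: b_def)
  have cont': "continuous_on (U \<times> cball (z u) r) (\<lambda>p. f (snd p, fst p))"
    by (rule continuous_on_compose2[OF cont]) (auto intro!: continuous_intros)
  obtain X where X: "u \<in> X" "open X"
    and near: "\<forall>v\<in>X \<inter> U. \<forall>y\<in>cball (z u) r. dist (f (y, v)) (f (y, u)) \<le> b"
    by (rule continuous_on_prod_compactE[OF cont' compact_cball u b, unfolded fst_conv snd_conv])
      (rule that)
  have "z v \<in> ball (z u) e" if v: "v \<in> X \<inter> U" for v
  proof (rule ccontr)
    assume "z v \<notin> ball (z u) e"
    then have far: "norm (z v - z u) \<ge> r"
      using r by (simp add: dist_norm norm_minus_commute)
    have d: "\<bar>f (y, v) - f (y, u)\<bar> \<le> b" if "norm (y - z u) \<le> r" for y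
      using near v that by (auto simp: dist_norm norm_minus_commute)
    have "f (w, v) \<ge> f (z u, v) + 2 * b" if w: "norm (w - z u) = r" for w
    proof -
      have "f (w, u) \<ge> f (z u, u) + 4 * b"
        using growth[of w] w r by (simp add: b_def)
      moreover have "\<bar>f (w, v) - f (w, u)\<bar> \<le> b" "\<bar>f (z u, v) - f (z u, u)\<bar> \<le> b"
        using d[of w] d[of "z u"] w r by auto
      ultimately show ?thesis
        by linarith
    qed
    then have "f (z v, v) \<ge> f (z u, v) + 2 * b / r * norm (z v - z u)"
      using v by (intro convex_growth_beyond_sphere[OF cvx r(1) far]) auto
    moreover have "2 * b / r * norm (z v - z u) > 0"
      using b r far by (intro mult_pos_pos divide_pos_pos) auto
    ultimately show False
      using min[of v "z u"] v by simp
  qed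
  moreover obtain d where "d > 0" "ball u d \<subseteq> X \<inter> U"
    using open_contains_ball[of "X \<inter> U"] X U u by blast
  ultimately show "\<exists>d>0. \<forall>v. dist v u < d \<longrightarrow> dist (z v) (z u) < e"
    by (intro exI[of _ d]) (auto simp: dist_commute subset_iff)
qed

text \<open>Continuity of \<open>z\<close> allows the expansion of \<open>F\<close> to be evaluated
  at \<open>(z v, v)\<close>, where \<open>F\<close> vanishes. Applying \<open>A'\<close> bounds
  \<open>h + A' (B k)\<close> by a small multiple of \<open>norm h + norm k\<close>. A first use
  gives \<open>norm h\<close> of order \<open>norm k\<close>, a second one the derivative.\<close>

lemma implicit_function_derivative:
  fixes F :: "'a::real_normed_vector \<times> 'b::real_normed_vector \<Rightarrow> 'c::real_normed_vector"
  assumes F: "(F has_derivative (\<lambda>(h, k). A h + B k)) (at (z u, u))"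
    and z: "isCont z u" and U: "open U" "u \<in> U" and F0: "\<And>v. v \<in> U \<Longrightarrow> F (z v, v) = 0"
    and A': "bounded_linear A'" "\<And>h. A' (A h) = h" and B: "bounded_linear B"
  shows "(z has_derivative (\<lambda>k. - A' (B k))) (at u)"
  unfolding has_derivative_at_alt
proof (intro conjI allI impI)
  show "bounded_linear (\<lambda>k. - A' (B k))"
    using bounded_linear_compose[OF A'(1) B] by (rule bounded_linear_minus)
  obtain K where K: "K > 0" "\<And>y. norm (A' y) \<le> norm y * K"
    using bounded_linear.pos_bounded[OF A'(1)] by blast
  obtain M where M: "M > 0" "\<And>k. norm (A' (B k)) \<le> norm k * M"
    using bounded_linear.pos_bounded[OF bounded_linear_compose[OF A'(1) B]] by blast
  fix e :: real assume e: "e > 0"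
  \<comment> \<open>The first bound lets half of \<open>norm h\<close> be absorbed, giving
    \<open>norm h \<le> (2 * M + 1) * norm k\<close>. The second turns the resulting
    \<open>(2 * M + 2) * norm k\<close> into \<open>e * norm k\<close>.\<close>
  define \<eta> where "\<eta> = min (1 / (2 * K)) (e / (K * (2 * M + 2)))"
  have \<eta>: "\<eta> > 0" "\<eta> \<le> 1 / (2 * K)" "\<eta> \<le> e / (K * (2 * M + 2))"
    using K M e by (auto simp: \<eta>_def)
  have \<eta>K: "\<eta> * K \<le> 1 / 2" "\<eta> * K * (2 * M + 2) \<le> e"
    using mult_right_mono[OF \<eta>(2), of K] mult_right_mono[OF \<eta>(3), of "K * (2 * M + 2)"] K M
    by (simp_all add: mult.assoc)
  obtain d where d: "d > 0" and est: "\<And>w. norm (w - (z u, u)) < d \<Longrightarrow>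
      norm (F w - F (z u, u) - (case w - (z u, u) of (h, k) \<Rightarrow> A h + B k)) \<le> \<eta> * norm (w - (z u, u))"
    using F \<eta>(1) unfolding has_derivative_at_alt by blast
  obtain d1 where d1: "d1 > 0" "\<And>v. dist v u < d1 \<Longrightarrow> dist (z v) (z u) < d / 2"
    using z[unfolded continuous_at_eps_delta, rule_format, of "d / 2"] d by auto
  obtain d2 where d2: "d2 > 0" "ball u d2 \<subseteq> U"
    using U open_contains_ball by blast
  show "\<exists>d>0. \<forall>v. norm (v - u) < d \<longrightarrow> norm (z v - z u - - A' (B (v - u))) \<le> e * norm (v - u)"
  proof (intro exI[of _ "min (d / 2) (min d1 d2)"] conjI allI impI)
    fix v assume v: "norm (v - u) < min (d / 2) (min d1 d2)"
    define h where "h = z v - z u"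
    define k where "k = v - u"
    have vU: "v \<in> U"
      using v d2(2) by (auto simp: dist_norm norm_minus_commute subset_iff)
    have hk: "norm (h, k) \<le> norm h + norm k"
      by (rule norm_Pair_le)
    have "norm h < d / 2" "norm k < d / 2"
      using d1(2)[of v] v by (auto simp: h_def k_def dist_norm)
    then have "norm ((z v, v) - (z u, u)) < d"
      using hk by (simp add: h_def k_def)
    from est[OF this] have "norm (0 - 0 - (A h + B k)) \<le> \<eta> * norm (h, k)"
      unfolding F0[OF vU] F0[OF U(2)] h_def k_def by simp
    then have "norm (A h + B k) \<le> \<eta> * norm (h, k)"
      by (simp only: diff_self diff_0 norm_minus_cancel)
    also have "\<dots> \<le> \<eta> * (norm h + norm k)"
      using hk \<eta> by (intro mult_left_mono) auto
    finally have "norm (A h + B k) * K \<le> \<eta> * (norm h + norm k) * K"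
      using K by (intro mult_right_mono) auto
    then have "norm (A' (A h + B k)) \<le> (\<eta> * K) * (norm h + norm k)"
      using K(2)[of "A h + B k"] by (simp add: mult_ac)
    then have main: "norm (h + A' (B k)) \<le> (\<eta> * K) * (norm h + norm k)"
      using A'(2)[of h] linear_add[OF bounded_linear.linear[OF A'(1)], of "A h" "B k"] by simp
    also have "\<dots> \<le> 1 / 2 * (norm h + norm k)"
      using \<eta>K(1) by (intro mult_right_mono) auto
    finally have "norm (h + A' (B k)) \<le> 1 / 2 * (norm h + norm k)" .
    moreover have "norm h \<le> norm (h + A' (B k)) + norm (A' (B k))"
      using norm_triangle_ineq4[of "h + A' (B k)" "A' (B k)"] by simp
    ultimately have "norm h \<le> (2 * M + 1) * norm k"
      using M(2)[of k] by (simp add: algebra_simps)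
    then have "(\<eta> * K) * (norm h + norm k) \<le> (\<eta> * K) * ((2 * M + 2) * norm k)"
      using \<eta> K by (intro mult_left_mono) (auto simp: algebra_simps)
    also have "\<dots> \<le> e * norm k"
      using mult_right_mono[OF \<eta>K(2), of "norm k"] by (simp add: mult_ac)
    finally show "norm (z v - z u - - A' (B (v - u))) \<le> e * norm (v - u)"
      using main by (simp add: h_def k_def)
  qed (use d d1 d2 in auto)
qed

lemma positive_definite_inverse:
  fixes A :: "real^'n^'n"
  assumes "positive_definite A"
  obtains A' where "bounded_linear A'" "\<And>h. A' (A *v h) = h" "\<And>h. A *v A' h = h"
proof -
  have "A *v h \<noteq> 0" if "h \<noteq> 0" for h
    using assms that unfolding positive_definite_def by (metis inner_zero_right less_irrefl)
  then have inj: "inj ((*v) A)"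
    by (subst linear_injective_0) auto
  obtain A' where "linear A'" "\<forall>h. A' (A *v h) = h" "\<forall>h. A *v A' h = h"
    using linear_injective_isomorphism[OF _ inj] by auto
  then show thesis
    by (intro that[of A']) (simp only: linear_conv_bounded_linear, (erule allE, assumption)+)
qed

text \<open>\<open>D_minimizer\<close> is a Jacobian, so its value is known only after
  differentiability is proved; the implicit derivative is minus the inverse Hessian applied to
  \<open>grad_xu\<close>.\<close>

lemma D_minimizer_equation:
  fixes f :: "(real^'n) \<times> (real^'p) \<Rightarrow> real"
  assumes U: "open U" "u \<in> U" and C2: "C2_on f (UNIV \<times> U)"
    and pd: "positive_definite (hess_x f (minimizer f u) u)"
    and cont: "isCont (minimizer f) u"
    and crit: "\<And>v. v \<in> U \<Longrightarrow> grad_x f (minimizer f v) v = 0"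
  shows "hess_x f (minimizer f u) u *v (D_minimizer f u *v s) + grad_xu f (minimizer f u) u *v s = 0"
proof -
  let ?A = "hess_x f (minimizer f u) u" and ?B = "grad_xu f (minimizer f u) u"
  obtain A' where A': "bounded_linear A'" "\<And>h. A' (?A *v h) = h" "\<And>h. ?A *v A' h = h"
    using positive_definite_inverse[OF pd] by blast
  have "((\<lambda>(y, v). grad_x f y v) has_derivative (\<lambda>(h, k). ?A *v h + ?B *v k)) (at (minimizer f u, u))"
    by (rule C2_on_derivative_grad_x(1)[OF C2 U])
  then have der: "(minimizer f has_derivative (\<lambda>k. - A' (?B *v k))) (at u)"
    by (rule implicit_function_derivative[OF _ cont U _ A'(1,2)]) (simp_all add: crit)
  have "D_minimizer f u *v s = - A' (?B *v s)"
    unfolding D_minimizer_def jacobian_def frechet_derivative_at[OF der, symmetric]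
    by (rule fun_cong[OF matrix_vector_mul(2)[OF has_derivative_linear[OF der]]])
  then have "?A *v (D_minimizer f u *v s) = - (?A *v A' (?B *v s))"
    using linear_neg[OF matrix_vector_mul_linear, of ?A] by simp
  then show ?thesis
    by (simp add: A'(3))
qed

subsection \<open>Convergence of the derivative iterates\<close>

text \<open>The upper bound \<open>L\<close> makes \<open>I - \<alpha> A\<close> positive
  semidefinite and coercivity with \<open>\<mu>\<close> bounds its form by
  \<open>1 - \<alpha> * \<mu>\<close>; \<open>psd_norm_le\<close> converts this into a norm
  bound.\<close>

lemma identity_minus_psd_contraction:
  fixes A :: "'a::euclidean_space \<Rightarrow> 'a"
  assumes lin: "linear A" and sym: "\<And>v w. v \<bullet> A w = w \<bullet> A v"
    and pos: "\<And>v. v \<noteq> 0 \<Longrightarrow> v \<bullet> A v > 0" and le: "\<And>v. v \<bullet> A v \<le> L * (norm v)\<^sup>2"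
    and \<alpha>: "0 < \<alpha>" "\<alpha> * L \<le> 1"
  obtains q where "0 \<le> q" "q < 1" "\<And>v. norm (v - \<alpha> *\<^sub>R A v) \<le> q * norm v"
proof -
  obtain \<mu> where \<mu>: "\<mu> > 0" "\<And>v. \<mu> * (norm v)\<^sup>2 \<le> v \<bullet> A v"
    using positive_form_coercive[OF lin pos] by blast
  \<comment> \<open>The maximum with 0 gives the nonnegativity that \<open>psd_norm_le\<close>
    requires, without comparing \<open>\<mu>\<close> and \<open>L\<close>.\<close>
  define q where "q = max 0 (1 - \<alpha> * \<mu>)"
  have form: "v \<bullet> (v - \<alpha> *\<^sub>R A v) = (norm v)\<^sup>2 - \<alpha> * (v \<bullet> A v)" for v
    by (simp add: inner_diff_right power2_norm_eq_inner)
  have "norm (v - \<alpha> *\<^sub>R A v) \<le> q * norm v" for v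
  proof (rule psd_norm_le)
    show "linear (\<lambda>v. v - \<alpha> *\<^sub>R A v)"
      using lin by (intro linear_compose_sub linear_id[unfolded id_def] linear_compose_scale_right)
    show "v \<bullet> (w - \<alpha> *\<^sub>R A w) = w \<bullet> (v - \<alpha> *\<^sub>R A v)" for v w
      using sym[of v w] by (simp add: inner_diff_right inner_commute)
    fix v
    have "\<alpha> * (v \<bullet> A v) \<le> (\<alpha> * L) * (norm v)\<^sup>2"
      using mult_left_mono[OF le[of v], of \<alpha>] \<alpha> by (simp add: mult.assoc)
    also have "\<dots> \<le> 1 * (norm v)\<^sup>2"
      using \<alpha> by (intro mult_right_mono) auto
    finally show "0 \<le> v \<bullet> (v - \<alpha> *\<^sub>R A v)"
      unfolding form by simp
    have "(1 - \<alpha> * \<mu>) * (norm v)\<^sup>2 \<le> q * (norm v)\<^sup>2"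
      by (intro mult_right_mono) (auto simp: q_def)
    moreover have "\<alpha> * (\<mu> * (norm v)\<^sup>2) \<le> \<alpha> * (v \<bullet> A v)"
      using mult_left_mono[OF \<mu>(2), of \<alpha>] \<alpha> by simp
    ultimately show "v \<bullet> (v - \<alpha> *\<^sub>R A v) \<le> q * (norm v)\<^sup>2"
      unfolding form by (simp add: left_diff_distrib mult.assoc)
  qed (simp add: q_def)
  moreover have "0 \<le> q" "q < 1"
    using \<mu> \<alpha> by (auto simp: q_def)
  ultimately show thesis
    using that by blast
qed

text \<open>The step map has derivative \<open>I - \<alpha> H\<close> and fixes \<open>z\<close>;
  the mean value inequality on the convex ball gives the factor \<open>q\<close>.\<close>

lemma gradient_step_contraction:
  fixes G :: "'a::euclidean_space \<Rightarrow> 'a"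
  assumes G: "\<And>y. (G has_derivative H y) (at y)" and G0: "G z = 0"
    and H: "\<And>y w. norm (y - z) \<le> \<delta> \<Longrightarrow> norm (w - \<alpha> *\<^sub>R H y w) \<le> q * norm w"
    and q: "0 \<le> q" and y: "norm (y - z) \<le> \<delta>"
  shows "norm (y - \<alpha> *\<^sub>R G y - z) \<le> q * norm (y - z)"
proof -
  have "norm ((y - \<alpha> *\<^sub>R G y) - (z - \<alpha> *\<^sub>R G z)) \<le> q * norm (y - z)"
  proof (rule differentiable_bound[OF convex_cball])
    fix w assume w: "w \<in> cball z \<delta>"
    show "((\<lambda>y. y - \<alpha> *\<^sub>R G y) has_derivative (\<lambda>h. h - \<alpha> *\<^sub>R H w h)) (at w within cball z \<delta>)"
      by (intro derivative_intros has_derivative_at_withinI[OF G])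
    show "onorm (\<lambda>h. h - \<alpha> *\<^sub>R H w h) \<le> q"
      using w by (intro onorm_le H) (simp add: dist_norm norm_minus_commute)
  next
    show "y \<in> cball z \<delta>"
      using y by (simp add: dist_norm norm_minus_commute)
    have "0 \<le> \<delta>"
      using y norm_ge_zero order_trans by blast
    then show "z \<in> cball z \<delta>"
      by simp
  qed
  then show ?thesis
    by (simp add: G0)
qed

lemma tendsto_of_power_bound:
  fixes X :: "nat \<Rightarrow> 'a::real_normed_vector"
  assumes q: "0 \<le> q" "q < 1"
    and bound: "\<And>k. k \<ge> k0 \<Longrightarrow> norm (X k - l) \<le> q ^ (k - k0) * A + C * real (k - k0) * q ^ (k - k0) * B"
  shows "X \<longlonglongrightarrow> l"
proof (rule LIMSEQ_offset[where k = k0])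
  have "(\<lambda>n. q ^ n * A + C * (real n * q ^ n) * B) \<longlonglongrightarrow> 0 * A + C * 0 * B"
    using q by (intro tendsto_intros LIMSEQ_power_zero powser_times_n_limit_0) auto
  then have lim: "(\<lambda>n. q ^ n * A + C * (real n * q ^ n) * B) \<longlonglongrightarrow> 0"
    by simp
  have "norm (X (n + k0) - l) \<le> q ^ n * A + C * (real n * q ^ n) * B" for n
    using bound[of "n + k0"] by (simp add: mult.assoc)
  then have "(\<lambda>n. X (n + k0) - l) \<longlonglongrightarrow> 0"
    by (intro Lim_null_comparison[OF _ lim] always_eventually allI)
  then show "(\<lambda>n. X (n + k0)) \<longlonglongrightarrow> l"
    by (simp add: LIM_zero_iff)
qed

theorem mainTheorem2:
  fixes f :: "(real^'n) \<times> (real^'p) \<Rightarrow> real"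
    and U :: "(real^'p) set"
    and \<epsilon> m L :: "real^'p \<Rightarrow> real"
    and \<kappa> C \<alpha> :: real
    and a :: "real^'n"
    and u s :: "real^'p"
    and x xd :: "nat \<Rightarrow> real^'n"
  assumes U: "open U" "U \<noteq> {}" "bounded U"
    and f_C2: "C2_on f (UNIV \<times> U)"
    and f_convex: "\<And>v. v \<in> U \<Longrightarrow> convex_on UNIV (\<lambda>y. f (y, v))"
    and f_min: "\<And>v. v \<in> U \<Longrightarrow> \<exists>!y. is_arg_min (\<lambda>y. f (y, v)) (\<lambda>_. True) y"
    and pos_def: "\<And>v. v \<in> U \<Longrightarrow> positive_definite (hess_x f (minimizer f v) v)"
    and eps: "\<And>v. v \<in> U \<Longrightarrow> \<epsilon> v > 0"
    and m: "\<And>v. v \<in> U \<Longrightarrow> m v > 0"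
    and str_convex: "\<And>v. v \<in> U \<Longrightarrow>
          strongly_convex_on (m v) (cball (minimizer f v) (\<epsilon> v)) (\<lambda>y. f (y, v))"
    and a: "\<And>v. v \<in> U \<Longrightarrow> cball (minimizer f v) (\<epsilon> v) \<subseteq> level_set f a v"
    and L_pos: "\<And>v. v \<in> U \<Longrightarrow> L v > 0"
    and L: "\<And>v y l. v \<in> U \<Longrightarrow> y \<in> level_set f a v \<Longrightarrow> eigenvalue (hess_x f y v) l \<Longrightarrow> l \<le> L v"
    and \<kappa>_pos: "\<kappa> > 0"
    and \<kappa>: "\<And>y v. (y, v) \<in> Z_set f a U \<Longrightarrow> onorm ((*v) (grad_xu f y v)) \<le> \<kappa>"
    and C: "C \<ge> 0"
    and lip: "lipschitz_on C (Z_set f a U) (D_grad_x f)"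
    and u: "u \<in> U"
    and \<alpha>: "0 < \<alpha>" "\<alpha> \<le> 1 / L u"
    and x_0: "x 0 = a"
    and x_Suc: "\<And>k. x (Suc k) = x k - \<alpha> *\<^sub>R grad_x f (x k) u"
    and xd_0: "xd 0 = 0"
    and xd_Suc: "\<And>k. xd (Suc k) =
          (mat 1 - \<alpha> *\<^sub>R hess_x f (x k) u) *v xd k - \<alpha> *\<^sub>R (grad_xu f (x k) u *v s)"
  shows "xd \<longlonglongrightarrow> D_minimizer f u *v s \<and>
    (\<exists>k0::nat. \<exists>C1::real. \<exists>q::real. C1 > 0 \<and> 0 \<le> q \<and> q < 1 \<and>
      (\<forall>k\<ge>k0.
        norm (xd k - D_minimizer f u *v s)
          \<le> q ^ (k - k0) * norm (xd k0 - D_minimizer f u *v s)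
            + C1 * real (k - k0) * q ^ (k - k0) * norm (x k0 - minimizer f u)))"
proof -
  define z where "z = minimizer f u"
  define d where "d = D_minimizer f u *v s"
  define G where "G y = grad_x f y u" for y
  define H where "H y = (*v) (hess_x f y u)" for y
  define B where "B y = (*v) (grad_xu f y u)" for y
  have H: "linear (H y)" for y
    by (simp add: H_def)
  have min: "f (minimizer f v, v) \<le> f (y, v)" if "v \<in> U" for y v
    by (rule minimizer_le[OF f_min[OF that]])
  have G: "((\<lambda>y. f (y, u)) has_derivative (\<lambda>h. h \<bullet> G y)) (at y)" for y
    unfolding G_def by (rule C2_on_GDERIV_grad_x[OF f_C2 u])
  have GH: "(G has_derivative H y) (at y)" for y
    unfolding G_def H_def by (rule C2_on_derivative_grad_x(2)[OF f_C2 U(1) u])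
  have crit: "grad_x f (minimizer f v) v = 0" if "v \<in> U" for v
    by (rule grad_x_minimizer_eq_0[OF C2_on_GDERIV_grad_x[OF f_C2 that] min[OF that]])
  have Gz: "G z = 0"
    unfolding G_def z_def by (rule crit[OF u])
  have zmin: "f (z, u) \<le> f (y, u)" for y
    unfolding z_def by (rule min[OF u])
  have sc: "strongly_convex_on (m u) (cball z (\<epsilon> u)) (\<lambda>y. f (y, u))"
    unfolding z_def by (rule str_convex[OF u])
  have ball_level: "cball z (\<epsilon> u) \<subseteq> level_set f a u"
    unfolding z_def by (rule a[OF u])
  then have z_level: "z \<in> level_set f a u"
    using eps[OF u] by auto
  \<comment> \<open>Symmetry at every \<open>y\<close>, not only at \<open>z\<close>, is what turns
    the eigenvalue bound into \<open>H_le\<close>.\<close>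
  have sym: "v \<bullet> H y w = w \<bullet> H y v" for v w y
    by (rule derivative_gradient_symmetric[OF G GH])
  have H_le: "v \<bullet> H y v \<le> L u * (norm v)\<^sup>2" if y: "y \<in> level_set f a u" for y v
  proof (rule symmetric_le_of_eigenvalues_le[OF H sym])
    fix w l assume "w \<noteq> 0" "H y w = l *\<^sub>R w"
    then show "l \<le> L u"
      by (intro L[OF u y]) (auto simp: eigenvalue_def H_def)
  qed
  have decrease: "f (y - \<alpha> *\<^sub>R G y, u) \<le> f (y, u) - \<alpha> / 2 * (norm (G y))\<^sup>2"
    if "y \<in> level_set f a u" for y
    using gradient_step_decrease[OF G GH f_convex[OF u], of "f (a, u)" "L u" y \<alpha>] H_le L_pos[OF u] \<alpha> that
    by (simp add: level_set_def)
  have x_Suc': "x (Suc k) = x k - \<alpha> *\<^sub>R G (x k)" for k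
    by (simp add: x_Suc G_def)
  have x_level: "x k \<in> level_set f a u" for k
  proof (induction k)
    case (Suc k)
    have "0 \<le> \<alpha> / 2 * (norm (G (x k)))\<^sup>2"
      using \<alpha> by simp
    then show ?case
      using decrease[OF Suc] Suc by (simp add: level_set_def x_Suc')
  qed (simp add: x_0 level_set_def)
  have x_lim: "x \<longlonglongrightarrow> z"
    by (rule gradient_descent_tendsto[OF G f_convex[OF u] zmin sc m[OF u] eps[OF u], where c = "\<alpha> / 2"])
      (use decrease[OF x_level] \<alpha> in \<open>auto simp: x_Suc'\<close>)
  have "isCont (minimizer f) u"
  proof (rule continuous_minimizers[OF C2_on_imp_continuous_on[OF f_C2] U(1) u f_convex min])
    show "f (y, u) \<ge> f (minimizer f u, u) + m u / 4 * (norm (y - minimizer f u))\<^sup>2"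
      if "norm (y - minimizer f u) \<le> \<epsilon> u" for y
      by (rule strongly_convex_growth[OF str_convex[OF u] min[OF u] that])
  qed (use m[OF u] eps[OF u] in auto)
  then have d_eq: "H z d + B z s = 0"
    unfolding H_def B_def d_def z_def
    by (intro D_minimizer_equation[OF U(1) u f_C2 pos_def[OF u]] crit)
  have lip_H: "norm (H y w - H z w) \<le> C * norm (y - z) * norm w"
    and lip_B: "norm (B y r - B z r) \<le> C * norm (y - z) * norm r"
    if "y \<in> level_set f a u" for y w r
    unfolding H_def B_def by (rule lipschitz_hess_x_grad_xu[OF f_C2 U(1) u lip that z_level])+
  have Hz_pos: "v \<bullet> H z v > 0" if "v \<noteq> 0" for v
    using pos_def[OF u] that by (simp add: positive_definite_def H_def z_def)
  have "\<alpha> * L u \<le> 1"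
    using \<alpha>(2) L_pos[OF u] by (simp add: field_simps)
  then obtain q0 where q0: "0 \<le> q0" "q0 < 1" and Hz: "\<And>v. norm (v - \<alpha> *\<^sub>R H z v) \<le> q0 * norm v"
    using identity_minus_psd_contraction[OF H sym Hz_pos H_le[OF z_level] \<alpha>(1)] by blast
  \<comment> \<open>The midpoint between \<open>q0\<close> and 1 leaves the gap
    \<open>(1 - q0) / 2\<close> for the variation of the Hessian near \<open>z\<close>, and it is
    positive even if \<open>q0 = 0\<close>, as the division by \<open>q\<close> demands.\<close>
  define q where "q = (1 + q0) / 2"
  have q: "0 < q" "q < 1"
    using q0 by (auto simp: q_def)
  obtain t where t: "t > 0" "t * (\<alpha> * C) < (1 - q0) / 2"
    using small_multiple_less[of "\<alpha> * C" "(1 - q0) / 2"] \<alpha> C q0 by auto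
  \<comment> \<open>Radius \<open>\<epsilon> u\<close> keeps the ball in the level set, where the
    Lipschitz bound holds; radius \<open>t\<close> keeps the Hessian perturbation within the
    gap.\<close>
  define \<delta> where "\<delta> = min (\<epsilon> u) t"
  have \<delta>: "\<delta> > 0" "\<delta> \<le> \<epsilon> u" "\<delta> \<le> t"
    using t eps[OF u] by (auto simp: \<delta>_def)
  have contract: "norm (w - \<alpha> *\<^sub>R H y w) \<le> q * norm w" if y: "norm (y - z) \<le> \<delta>" for y w
  proof -
    have "y \<in> level_set f a u"
      using ball_level y \<delta> by (auto simp: dist_norm norm_minus_commute subset_iff)
    then have "\<alpha> * norm (H y w - H z w) \<le> \<alpha> * (C * norm (y - z) * norm w)"
      using \<alpha> by (intro mult_left_mono lip_H) auto
    also have "\<dots> \<le> \<alpha> * (C * t * norm w)"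
      using \<alpha> C y \<delta> by (intro mult_left_mono mult_right_mono) auto
    also have "\<dots> = (t * (\<alpha> * C)) * norm w"
      by simp
    also have "\<dots> \<le> (1 - q0) / 2 * norm w"
      using t by (intro mult_right_mono) auto
    finally have "\<alpha> * norm (H y w - H z w) \<le> (1 - q0) / 2 * norm w" .
    moreover have "w - \<alpha> *\<^sub>R H y w = (w - \<alpha> *\<^sub>R H z w) - \<alpha> *\<^sub>R (H y w - H z w)"
      by (simp add: algebra_simps)
    then have "norm (w - \<alpha> *\<^sub>R H y w) \<le> norm (w - \<alpha> *\<^sub>R H z w) + norm (\<alpha> *\<^sub>R (H y w - H z w))"
      by (metis norm_triangle_ineq4)
    moreover have "norm (\<alpha> *\<^sub>R (H y w - H z w)) = \<alpha> * norm (H y w - H z w)"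
      using \<alpha> by simp
    moreover have "q * norm w = q0 * norm w + (1 - q0) / 2 * norm w"
      by (simp add: q_def field_simps)
    ultimately show ?thesis
      using Hz[of w] by linarith
  qed
  obtain k0 where k0: "\<And>k. k \<ge> k0 \<Longrightarrow> norm (x k - z) \<le> \<delta>"
    using LIMSEQ_D[OF x_lim \<delta>(1)] by (meson less_imp_le)
  have e_step: "norm (x (Suc k) - z) \<le> q * norm (x k - z)" if "k \<ge> k0" for k
    unfolding x_Suc' by (rule gradient_step_contraction[OF GH Gz contract _ k0[OF that]]) (use q in auto)
  \<comment> \<open>The summand 1 keeps \<open>K\<close> positive when \<open>C = 0\<close> or
    \<open>d = s = 0\<close>, since the constant \<open>K / q\<close> has to be positive.\<close>
  define K where "K = \<alpha> * C * (norm d + norm s) + 1"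
  have K: "K > 0"
    using \<alpha> C by (simp add: K_def add_nonneg_pos)
  have d_step: "norm (xd (Suc k) - d) \<le> q * norm (xd k - d) + K * norm (x k - z)" if k: "k \<ge> k0" for k
  proof -
    \<comment> \<open>Splitting \<open>xd k\<close> as \<open>(xd k - d) + d\<close> makes the
      Hessian difference act on the fixed vector \<open>d\<close>, so no bound on \<open>xd\<close>
      is needed beforehand. Subtracting \<open>d_eq\<close> turns the source into differences that
      are Lipschitz in \<open>x k - z\<close>.\<close>
    let ?r = "(H (x k) d - H z d) + (B (x k) s - B z s)"
    have "xd (Suc k) = xd k - \<alpha> *\<^sub>R H (x k) (xd k) - \<alpha> *\<^sub>R B (x k) s"
      by (simp add: xd_Suc H_def B_def matrix_vector_mult_diff_rdistrib scaleR_matrix_vector_assoc)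
    moreover have "H (x k) (xd k - d) = H (x k) (xd k) - H (x k) d"
      by (rule linear_diff[OF H])
    ultimately have "xd (Suc k) - d = ((xd k - d) - \<alpha> *\<^sub>R H (x k) (xd k - d))
        - \<alpha> *\<^sub>R (H (x k) d + B (x k) s)"
      by (simp add: scaleR_diff_right scaleR_add_right)
    also have "H (x k) d + B (x k) s = ?r"
      using d_eq by (simp add: algebra_simps)
    finally have "xd (Suc k) - d = ((xd k - d) - \<alpha> *\<^sub>R H (x k) (xd k - d)) - \<alpha> *\<^sub>R ?r" .
    then have "norm (xd (Suc k) - d) \<le> norm ((xd k - d) - \<alpha> *\<^sub>R H (x k) (xd k - d)) + norm (\<alpha> *\<^sub>R ?r)"
      by (metis norm_triangle_ineq4)
    also have "\<dots> \<le> q * norm (xd k - d) + \<alpha> * norm ?r"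
      using contract[OF k0[OF k]] \<alpha> by simp
    also have "\<alpha> * norm ?r \<le> \<alpha> * (C * norm (x k - z) * norm d + C * norm (x k - z) * norm s)"
      using \<alpha> by (intro mult_left_mono norm_triangle_mono lip_H lip_B x_level) auto
    also have "\<dots> = (K - 1) * norm (x k - z)"
      by (simp add: K_def algebra_simps)
    also have "\<dots> \<le> K * norm (x k - z)"
      by (intro mult_right_mono) auto
    finally show ?thesis
      by simp
  qed
  have bound: "norm (xd k - d)
      \<le> q ^ (k - k0) * norm (xd k0 - d) + K / q * real (k - k0) * q ^ (k - k0) * norm (x k0 - z)"
    if "k \<ge> k0" for k
    using coupled_linear_recurrence[of k0 "\<lambda>k. norm (x k - z)" q "\<lambda>k. norm (xd k - d)" K "k - k0"]
      e_step d_step q K that by simp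
  have "xd \<longlonglongrightarrow> d"
    by (rule tendsto_of_power_bound[OF _ q(2) bound]) (use q in auto)
  moreover have "K / q > 0"
    using K q by simp
  ultimately show ?thesis
    unfolding d_def[symmetric] z_def[symmetric]
    using bound q by (intro conjI exI[of _ k0] exI[of _ "K / q"] exI[of _ q]) auto
qed

end
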